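(* Let $\mathcal{T}_0$ be a finite tree with $|\mathcal{T}_0|\ge 2$ vertices and Wiener index $\mathcal{W}_0$, and let $(\mathcal{T}_t)_{t\ge0}$ be the tree sequence generated from $\mathcal{T}_0$ by Algorithm-I. Then for every $t\ge0$ the average shortest path length $\langle\mathcal{W}_t\rangle=\frac{\mathcal{W}_t}{|\mathcal{T}_t|(|\mathcal{T}_t|-1)/2}$ of $\mathcal{T}_t$ equals $$\langle\mathcal{W}_{t}\rangle=\frac{2}{5^{t}(|\mathcal{T}_{0}|-1)\,[5^{t}(|\mathcal{T}_{0}|-1)+1]}\left\{75^{t}\,\mathcal{W}_{0}-4\cdot5^{t}\left[\frac{15^{t}-5^{t}}{10}(|\mathcal{T}_{0}|-1)^{2}+\frac{15^{t}-1}{14}(|\mathcal{T}_{0}|-1)\right]\right\},$$ and, as $t\to\infty$, $$\langle\mathcal{W}_t\rangle\sim 3^t\sim|\mathcal{T}_t|^{\zeta},\qquad \zeta=\frac{\ln 3}{\ln 5},$$ where $\sim$ means equality of order up to positive constants (which may depend on $\mathcal{T}_0$).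
   Context: Algorithm-I: given a finite tree $\mathcal{T}_{t-1}$ ($t\ge1$), with $k_v(t-1)$ denoting the degree of vertex $v$ in $\mathcal{T}_{t-1}$, the tree $\mathcal{T}_t$ is obtained by performing two operations: (i) for each vertex $v$ of $\mathcal{T}_{t-1}$ and each edge of $\mathcal{T}_{t-1}$ incident with $v$, insert one new vertex into that edge, next to $v$; thus every edge $uv$ of $\mathcal{T}_{t-1}$ receives two new vertices and is replaced by a path $u,u',v',v$ of length $3$; (ii) for each vertex $v$ of $\mathcal{T}_{t-1}$, attach $k_v(t-1)$ new vertices as leaves to $v$. $|\mathcal{T}|$ denotes the number of vertices of a tree $\mathcal{T}$. The Wiener index of a tree is $\mathcal{W}_{\mathcal{T}}=\frac12\sum_{u,v\in\mathcal{T}}d_{uv}$ (sum over ordered pairs), with $d_{uv}$ the graph distance; $\mathcal{W}_t=\mathcal{W}_{\mathcal{T}_t}$. *)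

theory Defs
  imports "Graph_Theory.Graph_Theory" "HOL-Library.Landau_Symbols"
begin

text \<open>
  An undirected simple graph is a \<open>pair_graph\<close>: a finite, loop-free digraph without
  parallel arcs whose arc relation is symmetric, an edge \<open>uv\<close> being the pair of arcs
  \<open>(u,v)\<close> and \<open>(v,u)\<close>.

  The library's \<open>Digraph_Component.tree\<close> cannot be used for such graphs: its notion of
  cycle admits the closed walk \<open>u, v, u\<close> along a single edge. The cycles of the
  undirected graph are the library's cycles of length at least 3.
\<close>

definition undirected_tree :: "'a pair_pre_digraph \<Rightarrow> bool" where
  "undirected_tree G \<longleftrightarrow>
     pair_graph G \<and> Digraph_Component.connected (with_proj G) \<and>
     \<not> (\<exists>p. pre_digraph.cycle (with_proj G) p \<and> 3 \<le> length p)"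

text \<open>Length of a shortest walk; meaningful for connected vertices only, as
  \<open>real_of_ereal\<close> sends \<open>\<infinity>\<close> to 0.\<close>

definition graph_dist :: "'a pair_pre_digraph \<Rightarrow> 'a \<Rightarrow> 'a \<Rightarrow> real" where
  "graph_dist G u v = real_of_ereal (wf_digraph.\<mu> (with_proj G) (\<lambda>_. 1) u v)"

definition wiener_index :: "'a pair_pre_digraph \<Rightarrow> real" where
  "wiener_index G = 1 / 2 * (\<Sum>u\<in>pverts G. \<Sum>v\<in>pverts G. graph_dist G u v)"

definition avg_path_length :: "'a pair_pre_digraph \<Rightarrow> real" where
  "avg_path_length G =
     wiener_index G / (real (card (pverts G)) * (real (card (pverts G)) - 1) / 2)"

text \<open>
  \<open>H\<close> arises from \<open>G\<close> by one round of Algorithm-I, for some choice of names of the new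
  vertices: \<open>ins (u,v)\<close> is the vertex inserted into the edge \<open>uv\<close> next to \<open>u\<close>, so that
  \<open>uv\<close> becomes the path \<open>u, ins (u,v), ins (v,u), v\<close>, and \<open>leaf (v,i)\<close> is the \<open>i\<close>-th leaf
  attached to \<open>v\<close>. Since arcs come in both orientations, the out-degree is the degree of
  the undirected graph.
\<close>

definition leaf_slots :: "'a pair_pre_digraph \<Rightarrow> ('a \<times> nat) set" where
  "leaf_slots G = {(v, i). v \<in> pverts G \<and> i < out_degree (with_proj G) v}"

definition algorithm_I_step :: "'a pair_pre_digraph \<Rightarrow> 'a pair_pre_digraph \<Rightarrow> bool" where
  "algorithm_I_step G H \<longleftrightarrow>
     (\<exists>ins :: 'a \<times> 'a \<Rightarrow> 'a. \<exists>leaf :: 'a \<times> nat \<Rightarrow> 'a.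
        inj_on ins (parcs G) \<and> inj_on leaf (leaf_slots G) \<and>
        ins ` parcs G \<inter> pverts G = {} \<and>
        leaf ` leaf_slots G \<inter> pverts G = {} \<and>
        ins ` parcs G \<inter> leaf ` leaf_slots G = {} \<and>
        pverts H = pverts G \<union> ins ` parcs G \<union> leaf ` leaf_slots G \<and>
        parcs H =
          (\<Union>(u, v)\<in>parcs G. {(u, ins (u, v)), (ins (u, v), u), (ins (u, v), ins (v, u))}) \<union>
          (\<Union>(v, i)\<in>leaf_slots G. {(v, leaf (v, i)), (leaf (v, i), v)}))"

definition algorithm_I_sequence :: "(nat \<Rightarrow> 'a pair_pre_digraph) \<Rightarrow> bool" where
  "algorithm_I_sequence T \<longleftrightarrow> (\<forall>t. algorithm_I_step (T t) (T (Suc t)))"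

text \<open>Over an infinite vertex type every finite graph is the start of such a sequence.\<close>

lemma algorithm_I_step_exists:
  fixes G :: "'a pair_pre_digraph"
  assumes inf: "infinite (UNIV :: 'a set)"
    and fin: "finite (pverts G)" "finite (parcs G)"
  obtains H where "algorithm_I_step G H" "finite (pverts H)" "finite (parcs H)"
proof -
  have "leaf_slots G = Sigma (pverts G) (\<lambda>v. {..<out_degree (with_proj G) v})"
    by (auto simp: leaf_slots_def)
  then have finL: "finite (leaf_slots G)"
    using fin by auto
  have "infinite (UNIV - pverts G)"
    using inf fin by simp
  then obtain A where A: "finite A" "card A = card (parcs G)" "A \<subseteq> UNIV - pverts G"
    using infinite_arbitrarily_large by blast
  have "infinite (UNIV - (pverts G \<union> A))"
    using inf fin A by simp
  then obtain B where B: "finite B" "card B = card (leaf_slots G)" "B \<subseteq> UNIV - (pverts G \<union> A)"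
    using infinite_arbitrarily_large by blast
  obtain ins where ins: "bij_betw ins (parcs G) A"
    using finite_same_card_bij[OF fin(2) A(1)] A(2) by auto
  obtain leaf where leaf: "bij_betw leaf (leaf_slots G) B"
    using finite_same_card_bij[OF finL B(1)] B(2) by auto
  define H where "H = \<lparr> pverts = pverts G \<union> ins ` parcs G \<union> leaf ` leaf_slots G,
    parcs = (\<Union>(u, v)\<in>parcs G. {(u, ins (u, v)), (ins (u, v), u), (ins (u, v), ins (v, u))}) \<union>
            (\<Union>(v, i)\<in>leaf_slots G. {(v, leaf (v, i)), (leaf (v, i), v)}) \<rparr>"
  have "algorithm_I_step G H"
    unfolding algorithm_I_step_def H_def
    using A(3) B(3) ins leaf
    by (intro exI[of _ ins] exI[of _ leaf]) (auto simp: bij_betw_def)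
  moreover have "finite (pverts H)" "finite (parcs H)"
    using fin finL by (auto simp: H_def)
  ultimately show thesis ..
qed

lemma algorithm_I_sequence_exists:
  fixes G :: "'a pair_pre_digraph"
  assumes inf: "infinite (UNIV :: 'a set)" and "pair_graph G"
  obtains T where "T 0 = G" "algorithm_I_sequence T"
proof -
  let ?P = "\<lambda>n H. finite (pverts H) \<and> finite (parcs H) \<and> ((n::nat) = 0 \<longrightarrow> H = G)"
  interpret pair_graph G by fact
  have "\<exists>T. \<forall>n. ?P n (T n) \<and> algorithm_I_step (T n) (T (Suc n))"
  proof (rule dependent_nat_choice)
    show "\<exists>H. ?P 0 H"
      using pair_finite_verts pair_finite_arcs by blast
    show "\<exists>K. ?P (Suc n) K \<and> algorithm_I_step H K" if "?P n H" for n H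
      using that algorithm_I_step_exists[OF inf, of H] by (metis nat.distinct(1))
  qed
  then show thesis
    using that by (auto simp: algorithm_I_sequence_def)
qed

end

theory Submission
  imports Defs
begin

text \<open>
  A tree with its distance \<open>d\<close> is captured by three conditions: \<open>d\<close> vanishes on the diagonal,
  it changes by exactly one along every edge, and every vertex other than the chosen root
  \<open>x\<close> has exactly one neighbour closer to \<open>x\<close>. Such a \<open>d\<close> is necessarily the graph
  distance, so one round of Algorithm-I can be treated by writing down the new distance
  and checking the conditions. Summing it over all pairs only involves the degree-weighted sums
  of \<open>d\<close>, and these reduce to the plain ones: counting every edge at its two ends, seen from
  the root \<open>x\<close>, gives \<open>\<Sum>\<^sub>v k\<^sub>v d(x,v) = 2 \<Sum>\<^sub>v d(x,v) - (n - 1)\<close>. The outcome is the recursion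
  \<open>n - 1 \<mapsto> 5 (n - 1)\<close>, \<open>W \<mapsto> 75 W - 20 n (n - 1)\<close>. The coefficient of \<open>75^t\<close> in its solution is
  positive because \<open>W \<ge> n (n - 1) / 2\<close>.
\<close>

section \<open>Distance functions of trees\<close>

text \<open>Connectedness and acyclicity are implicit: descending to closer neighbours ends at
  \<open>x\<close>, and a farthest vertex on a cycle would have two neighbours closer to
  \<open>x\<close>.\<close>

locale tree_metric =
  fixes V :: "'a set" and A :: "('a \<times> 'a) set" and d :: "'a \<Rightarrow> 'a \<Rightarrow> nat"
  assumes finite_V: "finite V"
    and arcs_in_V: "A \<subseteq> V \<times> V"
    and arc_sym: "(u, v) \<in> A \<Longrightarrow> (v, u) \<in> A"
    and d_self: "x \<in> V \<Longrightarrow> d x x = 0"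
    and d_commute: "x \<in> V \<Longrightarrow> y \<in> V \<Longrightarrow> d x y = d y x"
    and d_arc: "x \<in> V \<Longrightarrow> (u, v) \<in> A \<Longrightarrow> d x u = Suc (d x v) \<or> d x v = Suc (d x u)"
    and parent: "x \<in> V \<Longrightarrow> y \<in> V \<Longrightarrow> y \<noteq> x \<Longrightarrow> \<exists>!p. (y, p) \<in> A \<and> d x y = Suc (d x p)"

text \<open>A walk increases \<open>d\<close> by at most one per arc, so no walk from
  \<open>x\<close> to \<open>y\<close> is shorter than \<open>d y\<close>; following predecessors
  back from \<open>y\<close> to \<open>x\<close> builds a walk of exactly that length.\<close>

lemma graph_dist_eqI:
  fixes G :: "'a pair_pre_digraph" and d :: "'a \<Rightarrow> nat"
  assumes wf: "pair_wf_digraph G"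
    and x: "x \<in> pverts G" "d x = 0"
    and lip: "\<And>u v. (u, v) \<in> parcs G \<Longrightarrow> d v \<le> Suc (d u)"
    and pred: "\<And>y. y \<in> pverts G \<Longrightarrow> y \<noteq> x \<Longrightarrow> \<exists>p. (p, y) \<in> parcs G \<and> d y = Suc (d p)"
    and y: "y \<in> pverts G"
  shows "graph_dist G x y = real (d y)"
proof -
  interpret pair_wf_digraph G by fact
  have cost: "awalk_cost (\<lambda>_. 1) p = real (length p)" for p :: "('a \<times> 'a) list"
    by (induct p) auto
  have lower: "d v \<le> d u + length p" if "awalk u p v" for u p v
    using that
  proof (induct p arbitrary: u)
    case Nil
    then show ?case by (simp add: awalk_Nil_iff)
  next
    case (Cons e p)
    have "(u, snd e) \<in> parcs G" "awalk (snd e) p v"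
      using Cons.prems by (auto simp: awalk_Cons_iff)
    then show ?case
      using lip[of u "snd e"] Cons.hyps[of "snd e"] by simp
  qed
  have upper: "\<exists>p. awalk x p y \<and> length p = d y"
    using y
  proof (induct "d y" arbitrary: y rule: less_induct)
    case less
    show ?case
    proof (cases "y = x")
      case True
      then show ?thesis using x by (auto simp: awalk_Nil_iff intro!: exI[of _ "[]"])
    next
      case False
      then obtain q where q: "(q, y) \<in> parcs G" "d y = Suc (d q)"
        using pred less.prems by blast
      then obtain p where p: "awalk x p q" "length p = d q"
        using less.hyps[of q] in_arcsD1 by auto
      have "awalk x (p @ [(q, y)]) y"
        using p(1) arc_implies_awalk[OF q(1)] by (auto intro: awalk_appendI)
      then show ?thesis using p(2) q(2) by (intro exI[of _ "p @ [(q, y)]"]) auto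
    qed
  qed
  have "\<mu> (\<lambda>_. 1) x y = ereal (real (d y))"
  proof (rule antisym)
    obtain p where "awalk x p y" "length p = d y" using upper by blast
    then show "\<mu> (\<lambda>_. 1) x y \<le> ereal (real (d y))"
      using min_cost_le_walk_cost[of x p y "\<lambda>_. 1"] by (simp add: cost)
    show "ereal (real (d y)) \<le> \<mu> (\<lambda>_. 1) x y"
      unfolding \<mu>_def using lower[of x _ y] x by (auto intro!: INF_greatest simp: cost)
  qed
  then show ?thesis by (simp add: graph_dist_def)
qed

lemma (in tree_metric) graph_dist_eq:
  assumes "pverts G = V" "parcs G = A" "x \<in> V" "y \<in> V"
  shows "graph_dist G x y = real (d x y)"
proof (rule graph_dist_eqI)
  show "pair_wf_digraph G"
    using arcs_in_V assms by unfold_locales auto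
  show "d x v \<le> Suc (d x u)" if "(u, v) \<in> parcs G" for u v
    using d_arc[of x u v] that assms by auto
  show "\<exists>p. (p, z) \<in> parcs G \<and> d x z = Suc (d x p)" if "z \<in> pverts G" "z \<noteq> x" for z
    using parent[of x z] that assms by (metis arc_sym)
qed (use assms d_self in auto)

text \<open>A path from \<open>u\<close> to \<open>v\<close> avoiding both orientations of the edge
  closes up with the arc \<open>(v, u)\<close> to a cycle. Its length is at least 3, since the path
  is neither empty (no loops) nor a single arc (that arc was removed).\<close>

lemma edge_is_bridge:
  fixes G :: "'a pair_pre_digraph"
  assumes "pair_graph G"
    and acyclic: "\<not> (\<exists>p. pre_digraph.cycle (with_proj G) p \<and> 3 \<le> length p)"
    and arc: "(v, u) \<in> parcs G"
  shows "(u, v) \<notin> (parcs G - {(u, v), (v, u)})\<^sup>*"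
proof
  assume reach: "(u, v) \<in> (parcs G - {(u, v), (v, u)})\<^sup>*"
  interpret pair_graph G by fact
  define H where "H = \<lparr>pverts = pverts G, parcs = parcs G - {(u, v), (v, u)}\<rparr>"
  interpret H: pair_wf_digraph H
    by unfold_locales (auto simp: H_def in_arcsD1 in_arcsD2)
  have "(u, v) \<in> (parcs H)\<^sup>*" "u \<in> pverts H" "v \<in> pverts H"
    using reach in_arcsD1[OF arc] in_arcsD2[OF arc] by (auto simp: H_def)
  then have "u \<rightarrow>\<^sup>*\<^bsub>with_proj H\<^esub> v"
    by (simp add: H.reachable_conv)
  then obtain p where p: "H.apath u p v" using H.reachable_apath by blast
  then have Hp: "set p \<subseteq> parcs H" "u \<in> pverts H" "pcas u p v" "distinct (pawalk_verts u p)"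
    by (auto simp: H.apath_def H.awalk_def)
  then have "awalk u p v" "distinct (awalk_verts u p)"
    by (auto simp: awalk_def H_def)
  then have "awalk v ((v, u) # p) v \<and> distinct (tl (awalk_verts v ((v, u) # p)))"
    using arc by (auto simp: awalk_Cons_iff)
  then have "cycle ((v, u) # p)" unfolding cycle_def by blast
  moreover have "2 \<le> length p"
  proof (rule ccontr)
    assume "\<not> 2 \<le> length p"
    then consider "p = []" | e where "p = [e]" 
      by (cases p; cases "tl p") auto
    then show False
    proof cases
      case 1
      then show False using Hp no_loops'[OF arc] by simp
    next
      case 2
      then show False using Hp by (auto simp: H_def)
    qed
  qed
  ultimately show False using acyclic by force
qed

text \<open>The distance is the least power of the arc relation joining two vertices. Connectedness
  makes it meaningful and supplies a parent; that every edge is a bridge makes the parent unique and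
  excludes equidistant neighbours.\<close>

lemma tree_metric_of_undirected_tree:
  fixes G :: "'a pair_pre_digraph"
  assumes tree: "undirected_tree G"
  obtains d where "tree_metric (pverts G) (parcs G) d"
proof -
  interpret pair_graph G using tree by (simp add: undirected_tree_def)
  define d where "d x y = (LEAST n. (x, y) \<in> parcs G ^^ n)" for x y
  have reach: "\<exists>n. (x, y) \<in> parcs G ^^ n" if "x \<in> pverts G" "y \<in> pverts G" for x y
  proof -
    have "x \<rightarrow>\<^sup>*\<^bsub>with_proj G\<^esub> y"
      using tree that reachable_mk_symmetric_eq sym_arcs
      by (auto simp: undirected_tree_def connected_def strongly_connected_def)
    then have "(x, y) \<in> (parcs G)\<^sup>*" by (simp add: reachable_conv)
    then show ?thesis by (simp add: rtrancl_power)
  qed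
  have least: "(x, y) \<in> parcs G ^^ d x y" if "x \<in> pverts G" "y \<in> pverts G" for x y
    using LeastI_ex[OF reach[OF that]] by (simp add: d_def)
  have le: "d x y \<le> n" if "(x, y) \<in> parcs G ^^ n" for x y n
    using that by (simp add: d_def Least_le)
  have lip: "d x v \<le> Suc (d x u)" if "x \<in> pverts G" "(u, v) \<in> parcs G" for x u v
    using least[of x u] that in_arcsD1 by (intro le) auto
  have pred: "\<exists>p. (y, p) \<in> parcs G \<and> d x y = Suc (d x p)"
    if xy: "x \<in> pverts G" "y \<in> pverts G" "y \<noteq> x" for x y
  proof (cases "d x y")
    case 0
    then show ?thesis using least[OF xy(1,2)] xy(3) by simp
  next
    case (Suc n)
    then obtain p where p: "(x, p) \<in> parcs G ^^ n" "(p, y) \<in> parcs G"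
      using least[OF xy(1,2)] by auto
    have "d x y = Suc (d x p)"
      using lip[OF xy(1) p(2)] le[OF p(1)] Suc by linarith
    then show ?thesis using p(2) arcs_symmetric by blast
  qed
  \<comment> \<open>Shortest paths back to \<open>x\<close> run inside \<open>low x k\<close>. An edge between equidistant vertices, or
    a second edge towards \<open>x\<close>, would therefore not be a bridge.\<close>
  define low where "low x k = {(a, b). (a, b) \<in> parcs G \<and> d x a \<noteq> d x b \<and> d x a \<le> k \<and> d x b \<le> k}" for x k
  have to_root: "(y, x) \<in> (low x k)\<^sup>*" if "x \<in> pverts G" "y \<in> pverts G" "d x y \<le> k" for x y k
    using that
  proof (induct "d x y" arbitrary: y rule: less_induct)
    case less
    show ?case
    proof (cases "y = x")
      case False
      then obtain p where p: "(y, p) \<in> parcs G" "d x y = Suc (d x p)"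
        using pred less.prems by blast
      have "(p, x) \<in> (low x k)\<^sup>*" using less.hyps[of p] less.prems p in_arcsD2 by auto
      moreover have "(y, p) \<in> low x k" using p less.prems by (auto simp: low_def)
      ultimately show ?thesis by (meson converse_rtrancl_into_rtrancl)
    qed simp
  qed
  have "sym (low x k)" for x k by (auto simp: low_def intro!: symI arcs_symmetric)
  \<comment> \<open>Both vertices are joined to \<open>x\<close> inside the symmetric relation
    \<open>low x k\<close>, hence to each other.\<close>
  then have low: "(y, z) \<in> (low x k)\<^sup>*"
    if "x \<in> pverts G" "y \<in> pverts G" "z \<in> pverts G" "d x y \<le> k" "d x z \<le> k" for x y z k
    using to_root[of x y k] to_root[of x z k] that by (meson rtrancl_trans sym_rtrancl symE)
  have bridge: "(u, v) \<notin> (parcs G - {(u, v), (v, u)})\<^sup>*" if "(v, u) \<in> parcs G" for u v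
    using edge_is_bridge[of G] that tree unfolding undirected_tree_def by blast
  have "tree_metric (pverts G) (parcs G) d"
  proof
    show "d x x = 0" for x using le[of x x 0] by simp
    show "d x y = d y x" for x y
    proof -
      have "(y, x) \<in> parcs G ^^ n" if "(x, y) \<in> parcs G ^^ n" for x y n
        using that
      proof (induct n arbitrary: y)
        case (Suc n)
        then obtain z where "(x, z) \<in> parcs G ^^ n" "(z, y) \<in> parcs G" by auto
        then show ?case using Suc.hyps relpow_Suc_I2 arcs_symmetric by metis
      qed simp
      then have "(x, y) \<in> parcs G ^^ n \<longleftrightarrow> (y, x) \<in> parcs G ^^ n" for n
        by blast
      then show ?thesis by (simp add: d_def)
    qed
    show "d x u = Suc (d x v) \<or> d x v = Suc (d x u)"
      if x: "x \<in> pverts G" and uv: "(u, v) \<in> parcs G" for x u v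
    proof (rule ccontr)
      assume "\<not> ?thesis"
      then have eq: "d x u = d x v"
        using lip[OF x uv] lip[OF x arcs_symmetric[OF uv]] by linarith
      have "(u, v) \<in> (low x (d x u))\<^sup>*"
        using low[of x u v "d x u"] eq x uv in_arcsD1 in_arcsD2 by auto
      moreover have "low x (d x u) \<subseteq> parcs G - {(u, v), (v, u)}"
        using eq by (auto simp: low_def)
      ultimately show False
        using bridge[OF arcs_symmetric[OF uv]] rtrancl_mono by blast
    qed
    show "\<exists>!p. (y, p) \<in> parcs G \<and> d x y = Suc (d x p)"
      if x: "x \<in> pverts G" and y: "y \<in> pverts G" "y \<noteq> x" for x y
    proof (rule ex_ex1I[OF pred[OF x y]])
      fix p q
      assume p: "(y, p) \<in> parcs G \<and> d x y = Suc (d x p)"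
        and q: "(y, q) \<in> parcs G \<and> d x y = Suc (d x q)"
      show "p = q"
      proof (rule ccontr)
        assume "p \<noteq> q"
        let ?E = "parcs G - {(p, y), (y, p)}"
        \<comment> \<open>\<open>y\<close> is at distance \<open>d x p + 1\<close>, so no arc of
          \<open>low x (d x p)\<close> touches it; the detour from \<open>p\<close> through
          \<open>q\<close> to \<open>y\<close> then avoids the edge between \<open>p\<close> and
          \<open>y\<close>.\<close>
        have "low x (d x p) \<subseteq> ?E" using p by (auto simp: low_def)
        then have "(p, q) \<in> ?E\<^sup>*"
          using low[of x p q "d x p"] p q x in_arcsD2 rtrancl_mono[of "low x (d x p)" ?E] by auto
        moreover have "(q, y) \<in> ?E" using q \<open>p \<noteq> q\<close> y arcs_symmetric no_loops' by blast
        ultimately have "(p, y) \<in> ?E\<^sup>*" by (rule rtrancl_into_rtrancl)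
        then show False using bridge[of y p] p by blast
      qed
    qed
  qed (use pair_finite_verts in_arcsD1 in_arcsD2 arcs_symmetric in auto)
  then show thesis by (rule that)
qed

section \<open>Distance sums in a tree\<close>

context tree_metric
begin

definition deg :: "'a \<Rightarrow> nat" where
  "deg v = card (A `` {v})"

lemma finite_A: "finite A"
  using finite_subset[OF arcs_in_V] finite_V by simp

lemma arc_verts: "(u, v) \<in> A \<Longrightarrow> u \<in> V" "(u, v) \<in> A \<Longrightarrow> v \<in> V"
  using arcs_in_V by auto

lemma sum_arcs:
  fixes f :: "'a \<Rightarrow> 'a \<Rightarrow> 'b::comm_monoid_add"
  shows "(\<Sum>(u, v)\<in>A. f u v) = (\<Sum>u\<in>V. \<Sum>v\<in>A `` {u}. f u v)"
proof -
  have "A = Sigma V (\<lambda>u. A `` {u})" using arcs_in_V by auto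
  moreover have "finite (A `` {u})" for u using finite_A by auto
  ultimately show ?thesis using sum.Sigma[of V "\<lambda>u. A `` {u}" f] finite_V by auto
qed

lemma sum_arcs_fst:
  fixes f :: "'a \<Rightarrow> real"
  shows "(\<Sum>(u, v)\<in>A. f u) = (\<Sum>v\<in>V. real (deg v) * f v)"
  by (simp add: sum_arcs deg_def)

lemma sum_arcs_swap: "(\<Sum>(u, v)\<in>A. f u v) = (\<Sum>(u, v)\<in>A. f v u)"
  by (rule sum.reindex_bij_witness[of _ prod.swap prod.swap]) (auto intro: arc_sym)

text \<open>Oriented towards \<open>x\<close>, every edge is the unique parent arc of its farther
  end; this identifies the edges with the vertices other than \<open>x\<close>.\<close>

lemma parent_arcs_bij:
  assumes "x \<in> V"
  shows "bij_betw fst {(w, p). (w, p) \<in> A \<and> d x w = Suc (d x p)} (V - {x})"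
proof (rule bij_betwI')
  fix e e'
  assume "e \<in> {(w, p). (w, p) \<in> A \<and> d x w = Suc (d x p)}"
    and "e' \<in> {(w, p). (w, p) \<in> A \<and> d x w = Suc (d x p)}"
  then obtain w p w' p' where "e = (w, p)" "(w, p) \<in> A" "d x w = Suc (d x p)"
    "e' = (w', p')" "(w', p') \<in> A" "d x w' = Suc (d x p')"
    by blast
  moreover from this have "w \<noteq> x" using d_self assms by auto
  ultimately show "fst e = fst e' \<longleftrightarrow> e = e'"
    using parent[OF assms, of w] arc_verts by auto
next
  fix e
  assume "e \<in> {(w, p). (w, p) \<in> A \<and> d x w = Suc (d x p)}"
  then show "fst e \<in> V - {x}"
    using d_self[OF assms] arc_verts by auto
next
  fix w
  assume "w \<in> V - {x}"
  then obtain p where "(w, p) \<in> A" "d x w = Suc (d x p)"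
    using parent[OF assms, of w] by blast
  then show "\<exists>e\<in>{(w, p). (w, p) \<in> A \<and> d x w = Suc (d x p)}. w = fst e"
    by force
qed

text \<open>By \<open>d_arc\<close> no edge joins equidistant vertices, so exactly one of its two
  arcs points towards \<open>x\<close>. The two arcs together collect \<open>f\<close> at both
  ends.\<close>

lemma sum_arcs_parent:
  fixes f :: "'a \<Rightarrow> real"
  assumes "x \<in> V"
  defines "U \<equiv> {(w, p). (w, p) \<in> A \<and> d x w = Suc (d x p)}"
  shows "(\<Sum>(u, v)\<in>A. f u) = (\<Sum>(w, p)\<in>U. f w + f p)"
proof -
  have fin: "finite U" using finite_subset[OF _ finite_A, of U] by (auto simp: U_def)
  have "A = U \<union> prod.swap ` U"
    using d_arc[OF assms(1)] arc_sym by (force simp: U_def image_iff)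
  moreover have "U \<inter> prod.swap ` U = {}" by (auto simp: U_def)
  ultimately have "(\<Sum>(u, v)\<in>A. f u) = (\<Sum>(u, v)\<in>U. f u) + (\<Sum>(u, v)\<in>prod.swap ` U. f u)"
    using sum.union_disjoint[of U "prod.swap ` U"] fin by simp
  also have "(\<Sum>(u, v)\<in>prod.swap ` U. f u) = (\<Sum>(w, p)\<in>U. f p)"
    by (subst sum.reindex) (auto intro!: sum.cong)
  finally show ?thesis by (simp add: sum.distrib split_def)
qed

lemma card_A:
  assumes "V \<noteq> {}"
  shows "real (card A) = 2 * (real (card V) - 1)"
proof -
  obtain x where x: "x \<in> V" using assms by blast
  have "real (card A) = 2 * real (card (V - {x}))"
    using sum_arcs_parent[OF x, of "\<lambda>_. 1"] bij_betw_same_card[OF parent_arcs_bij[OF x]]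
    by (simp add: split_def)
  also have "real (card (V - {x})) = real (card V) - 1"
    using x finite_V by (metis One_nat_def Suc_pred' card_Diff_singleton card_gt_0_iff empty_iff of_nat_1 of_nat_diff Suc_leI)
  finally show ?thesis .
qed

lemma sum_deg: "V \<noteq> {} \<Longrightarrow> (\<Sum>v\<in>V. real (deg v)) = 2 * (real (card V) - 1)"
  using card_A sum_arcs_fst[of "\<lambda>_. 1"] by (simp add: split_def)

text \<open>Seen from \<open>x\<close>, the parent of \<open>w\<close> is one step closer than
  \<open>w\<close>, so the edge between them contributes \<open>2 * d x w - 1\<close>; edges are
  enumerated by their farther ends \<open>w\<close>.\<close>

lemma sum_deg_dist:
  assumes x: "x \<in> V"
  shows "(\<Sum>v\<in>V. real (deg v) * real (d x v)) = 2 * (\<Sum>v\<in>V. real (d x v)) - (real (card V) - 1)"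
proof -
  let ?U = "{(w, p). (w, p) \<in> A \<and> d x w = Suc (d x p)}"
  have "(\<Sum>v\<in>V. real (deg v) * real (d x v)) = (\<Sum>(w, p)\<in>?U. real (d x w) + real (d x p))"
    using sum_arcs_parent[OF x] sum_arcs_fst[of "\<lambda>v. real (d x v)"] by simp
  also have "\<dots> = (\<Sum>e\<in>?U. 2 * real (d x (fst e)) - 1)"
    by (intro sum.cong) auto
  also have "\<dots> = (\<Sum>w\<in>V - {x}. 2 * real (d x w) - 1)"
    by (rule sum.reindex_bij_betw[OF parent_arcs_bij[OF x]])
  \<comment> \<open>The root's term is \<open>-1\<close>, because \<open>d x x = 0\<close>; the
    added \<open>1\<close> cancels it.\<close>
  also have "\<dots> = (\<Sum>w\<in>V. 2 * real (d x w) - 1) + 1"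
    using sum.remove[OF finite_V x, of "\<lambda>w. 2 * real (d x w) - 1"] d_self[OF x] by simp
  finally show ?thesis by (simp add: sum_subtractf sum_distrib_left)
qed

text \<open>The weight \<open>w v\<close> will be the number of vertices of the new tree located at
  \<open>v\<close>: itself, one inserted vertex per incident edge, and as many leaves. Each of the
  two weights is removed by \<open>sum_deg_dist\<close>.\<close>

lemma sum_weighted_dist:
  defines "n \<equiv> real (card V)" and "S \<equiv> (\<Sum>x\<in>V. \<Sum>y\<in>V. real (d x y))"
    and "w \<equiv> \<lambda>v. 1 + 2 * real (deg v)"
  assumes ne: "V \<noteq> {}"
  shows "(\<Sum>x\<in>V. \<Sum>y\<in>V. w x * w y * real (d x y)) = 25 * S - 12 * n * (n - 1) - 8 * (n - 1)\<^sup>2"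
proof -
  define R where "R x = (\<Sum>y\<in>V. real (d x y))" for x
  have wsum: "(\<Sum>y\<in>V. w y * real (d x y)) = 5 * R x - 2 * (n - 1)" if "x \<in> V" for x
  proof -
    have "(\<Sum>y\<in>V. w y * real (d x y)) = R x + 2 * (\<Sum>y\<in>V. real (deg y) * real (d x y))"
      by (simp add: w_def R_def distrib_right sum.distrib sum_distrib_left mult.assoc)
    then show ?thesis using sum_deg_dist[OF that] by (simp add: R_def n_def)
  qed
  have wR: "(\<Sum>x\<in>V. w x * R x) = 5 * S - 2 * n * (n - 1)"
  proof -
    have "(\<Sum>x\<in>V. w x * R x) = (\<Sum>y\<in>V. \<Sum>x\<in>V. w x * real (d x y))"
      unfolding R_def sum_distrib_left by (rule sum.swap)
    also have "\<dots> = (\<Sum>y\<in>V. \<Sum>x\<in>V. w x * real (d y x))"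
      by (intro sum.cong) (auto simp: d_commute)
    also have "\<dots> = (\<Sum>y\<in>V. 5 * R y - 2 * (n - 1))"
      by (intro sum.cong) (auto simp: wsum)
    also have "\<dots> = 5 * S - 2 * n * (n - 1)"
      by (simp add: sum_subtractf S_def R_def sum_distrib_left[symmetric] n_def)
    finally show ?thesis .
  qed
  have sw: "(\<Sum>x\<in>V. w x) = n + 4 * (n - 1)"
    using sum_deg[OF ne] by (simp add: w_def sum.distrib sum_distrib_left[symmetric] n_def)
  have "(\<Sum>x\<in>V. \<Sum>y\<in>V. w x * w y * real (d x y)) = (\<Sum>x\<in>V. w x * (5 * R x - 2 * (n - 1)))"
    by (intro sum.cong) (auto simp: wsum sum_distrib_left[symmetric] mult.assoc)
  also have "\<dots> = (\<Sum>x\<in>V. 5 * (w x * R x) - 2 * (n - 1) * w x)"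
    by (intro sum.cong) (auto simp: algebra_simps)
  also have "\<dots> = 5 * (\<Sum>x\<in>V. w x * R x) - 2 * (n - 1) * (\<Sum>x\<in>V. w x)"
    by (simp only: sum_subtractf sum_distrib_left)
  also have "\<dots> = 25 * S - 12 * n * (n - 1) - 8 * (n - 1)\<^sup>2"
    unfolding wR sw by algebra
  finally show ?thesis .
qed

text \<open>Distinct edges \<open>ab\<close> and \<open>uv\<close> linked at both ends would close a
  cycle. In terms of parents: if \<open>u\<close> is not \<open>a\<close>, then both
  \<open>b\<close> and the next vertex \<open>p\<close> from \<open>a\<close> towards
  \<open>u\<close> are neighbours of \<open>a\<close> closer to \<open>v\<close>.\<close>

lemma parallel_arcs:
  assumes ab: "(a, b) \<in> A" and uv: "(u, v) \<in> A"
    and "d a v = Suc (d a u)" "d b u = Suc (d b v)"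
  shows "u = a \<and> v = b"
proof -
  note V = arc_verts[OF ab] arc_verts[OF uv]
  have bu: "d b u = Suc (d a u)" "d b v = d a u"
    using d_arc[OF V(3) ab] d_arc[OF V(4) ab] assms(3,4)
      d_commute[OF V(1,3)] d_commute[OF V(1,4)] d_commute[OF V(2,3)] d_commute[OF V(2,4)]
    by linarith+
  have "u = a"
  proof (rule ccontr)
    assume "u \<noteq> a"
    then obtain p where p: "(a, p) \<in> A" "d u a = Suc (d u p)"
      using parent[of u a] V by blast
    have "p \<noteq> b" using p(2) bu(1) d_commute[OF V(1,3)] d_commute[OF V(2,3)] by auto
    \<comment> \<open>Since \<open>d a v = d a u + 1\<close>, a step from \<open>a\<close> towards
      \<open>u\<close> also approaches \<open>v\<close>.\<close>
    have "d v a = Suc (d v p)"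
      using d_arc[OF V(4) p(1)] d_arc[OF arc_verts(2)[OF p(1)] uv] p(2) assms(3)
        d_commute[OF V(1,3)] d_commute[OF V(1,4)]
        d_commute[OF V(3) arc_verts(2)[OF p(1)]] d_commute[OF V(4) arc_verts(2)[OF p(1)]]
      by linarith
    moreover have "d v a = Suc (d v b)"
      using bu(2) assms(3) d_commute[OF V(1,4)] d_commute[OF V(2,4)] by simp
    moreover have "v \<noteq> a" using assms(3) d_self V by auto
    ultimately show False using parent[of v a] ab p V \<open>p \<noteq> b\<close> by blast
  qed
  moreover from this have "d b v = 0" using bu d_self V by simp
  then have "v = b" using parent[of b v] V by fastforce
  ultimately show ?thesis by blast
qed

text \<open>Distinct vertices are at distance at least one. This crude bound suffices to keep the
  coefficient of the dominant growth positive.\<close>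

lemma sum_dist_ge: "real (card V) * (real (card V) - 1) \<le> (\<Sum>x\<in>V. \<Sum>y\<in>V. real (d x y))"
proof -
  have "real (card V) - 1 \<le> (\<Sum>y\<in>V. real (d x y))" if x: "x \<in> V" for x
  proof -
    have "(\<Sum>y\<in>V - {x}. 1) \<le> (\<Sum>y\<in>V - {x}. real (d x y))"
    proof (rule sum_mono)
      fix y
      assume "y \<in> V - {x}"
      then obtain p where "d x y = Suc (d x p)" using parent[OF x, of y] by blast
      then show "1 \<le> real (d x y)" by simp
    qed
    also have "\<dots> \<le> (\<Sum>y\<in>V. real (d x y))" by (intro sum_mono2) (auto simp: finite_V)
    finally show ?thesis using x finite_V by (simp add: card_Diff_singleton of_nat_diff card_gt_0_iff Suc_leI)
  qed
  then show ?thesis using sum_mono[of V "\<lambda>_. real (card V) - 1"] by simp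
qed

end

section \<open>One step of Algorithm-I\<close>

text \<open>Canonical names for the vertices of the new tree; \<open>Ins u v\<close> is the vertex
  inserted into the edge \<open>uv\<close> next to \<open>u\<close>. Arbitrary names are reached
  later by an injective renaming.\<close>

datatype 'a step_vertex = Old 'a | Ins 'a 'a | Leaf 'a nat

text \<open>An inserted vertex is located by the two ends of its old edge, \<open>near\<close> being
  the closer one. For old vertices and leaves both are the same old vertex, and
  \<open>height\<close> counts the extra edge to a leaf.\<close>

primrec near :: "'a step_vertex \<Rightarrow> 'a" where
  "near (Old v) = v"
| "near (Ins u v) = u"
| "near (Leaf v i) = v"

primrec far :: "'a step_vertex \<Rightarrow> 'a" where
  "far (Old v) = v"
| "far (Ins u v) = v"
| "far (Leaf v i) = v"

primrec height :: "'a step_vertex \<Rightarrow> nat" where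
  "height (Old v) = 0"
| "height (Ins u v) = 0"
| "height (Leaf v i) = 1"

context tree_metric
begin

definition step_V :: "'a step_vertex set" where
  "step_V = Old ` V \<union> (\<lambda>(u, v). Ins u v) ` A \<union> (\<lambda>(v, i). Leaf v i) ` (SIGMA v:V. {..<deg v})"

definition step_A :: "('a step_vertex \<times> 'a step_vertex) set" where
  "step_A =
     (\<Union>(u, v)\<in>A. {(Old u, Ins u v), (Ins u v, Old u), (Ins u v, Ins v u)}) \<union>
     (\<Union>(v, i)\<in>(SIGMA v:V. {..<deg v}). {(Old v, Leaf v i), (Leaf v i, Old v)})"

text \<open>
  The distance in the new tree of two distinct vertices. The position \<open>ins (u, v)\<close> lies one third
  along the edge \<open>uv\<close>, and the naive interpolation \<open>(4 d(u,a) + 2 d(v,a) + 2 d(u,b) + d(v,b)) / 3\<close>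
  simplifies to \<open>d(u,a) + d(v,a) + d(u,b)\<close> because \<open>d(u,a) + d(v,b) = d(v,a) + d(u,b)\<close> for
  different edges \<open>uv\<close> and \<open>ab\<close>. In this form it is also correct for \<open>ins (u, v)\<close> and
  \<open>ins (v, u)\<close>.
\<close>

definition core_d :: "'a step_vertex \<Rightarrow> 'a step_vertex \<Rightarrow> nat" where
  "core_d x y = height x + height y + d (near x) (near y) + d (far x) (near y) + d (near x) (far y)"

text \<open>The diagonal is set separately because \<open>core_d x x\<close> is 2, not 0, for
  inserted vertices and leaves.\<close>

definition step_d :: "'a step_vertex \<Rightarrow> 'a step_vertex \<Rightarrow> nat" where
  "step_d x y = (if x = y then 0 else core_d x y)"

section \<open>The new distance satisfies the tree conditions\<close>

lemma step_V_iff [simp]: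
  "Old v \<in> step_V \<longleftrightarrow> v \<in> V"
  "Ins u v \<in> step_V \<longleftrightarrow> (u, v) \<in> A"
  "Leaf v i \<in> step_V \<longleftrightarrow> v \<in> V \<and> i < deg v"
  by (auto simp: step_V_def)

lemma step_A_iff:
  "(Old u, y) \<in> step_A \<longleftrightarrow>
     (\<exists>v. (u, v) \<in> A \<and> y = Ins u v) \<or> (\<exists>i. u \<in> V \<and> i < deg u \<and> y = Leaf u i)"
  "(Ins u v, y) \<in> step_A \<longleftrightarrow> (u, v) \<in> A \<and> (y = Old u \<or> y = Ins v u)"
  "(Leaf u i, y) \<in> step_A \<longleftrightarrow> u \<in> V \<and> i < deg u \<and> y = Old u"
  by (auto simp: step_A_def)

lemma step_V_near_far:
  assumes "x \<in> step_V"
  shows "near x \<in> V" "far x \<in> V" "near x = far x \<or> (near x, far x) \<in> A"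
  using assms by (cases x; auto dest: arc_verts)+

lemma d_adjacent: "(u, v) \<in> A \<Longrightarrow> d u v = 1"
  using d_arc[of u u v] d_self[of u] arc_verts by auto

text \<open>Along each new edge only one summand of \<open>core_d\<close> changes: the distance of
  \<open>near x\<close> between \<open>Old u\<close> and \<open>Ins u v\<close>, that of
  \<open>far x\<close> between \<open>Ins u v\<close> and \<open>Ins v u\<close>, the height at a
  leaf. The ends of the edge are separate choices of \<open>x\<close> because of the
  diagonal.\<close>

lemma step_d_arc:
  assumes x: "x \<in> step_V" and yz: "(y, z) \<in> step_A"
  shows "step_d x y = Suc (step_d x z) \<or> step_d x z = Suc (step_d x y)"
proof -
  note nf = step_V_near_far[OF x]
  have old_ins: "step_d x (Old u) = Suc (step_d x (Ins u v)) \<or> step_d x (Ins u v) = Suc (step_d x (Old u))"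
    if uv: "(u, v) \<in> A" for u v
  proof -
    consider "x = Old u" | "x = Ins u v" | "x \<noteq> Old u" "x \<noteq> Ins u v" by blast
    then show ?thesis
      using d_adjacent[OF uv] d_adjacent[OF arc_sym[OF uv]] d_self arc_verts[OF uv] d_arc[OF nf(1) uv]
      by cases (auto simp: step_d_def core_d_def)
  qed
  have ins_ins: "step_d x (Ins u v) = Suc (step_d x (Ins v u)) \<or> step_d x (Ins v u) = Suc (step_d x (Ins u v))"
    if uv: "(u, v) \<in> A" for u v
  proof -
    have "u \<noteq> v" using d_adjacent[OF uv] d_self arc_verts[OF uv] by auto
    consider "x = Ins u v" | "x = Ins v u" | "x \<noteq> Ins u v" "x \<noteq> Ins v u" by blast
    then show ?thesis
      using d_adjacent[OF uv] d_adjacent[OF arc_sym[OF uv]] d_self arc_verts[OF uv] d_arc[OF nf(2) uv] \<open>u \<noteq> v\<close>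
      by cases (auto simp: step_d_def core_d_def)
  qed
  have leaf: "step_d x (Old u) = Suc (step_d x (Leaf u i)) \<or> step_d x (Leaf u i) = Suc (step_d x (Old u))"
    if "u \<in> V" for u i
  proof -
    consider "x = Old u" | "x = Leaf u i" | "x \<noteq> Old u" "x \<noteq> Leaf u i" by blast
    then show ?thesis
      using d_self[OF that] by cases (auto simp: step_d_def core_d_def)
  qed
  show ?thesis
    using yz old_ins ins_ins leaf by (cases y) (fastforce simp: step_A_iff)+
qed

text \<open>A leaf has one neighbour. An inserted vertex has two, and exactly one is closer. For an
  old vertex \<open>u\<close> the parent is \<open>x\<close> itself if \<open>near x = u\<close>,
  and otherwise the vertex inserted next to \<open>u\<close> into the old edge towards
  \<open>near x\<close>.\<close>

lemma step_parent:
  assumes x: "x \<in> step_V" and y: "y \<in> step_V" "y \<noteq> x"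
  shows "\<exists>!p. (y, p) \<in> step_A \<and> step_d x y = Suc (step_d x p)"
proof (cases y)
  case (Leaf u i)
  then have "step_d x y = Suc (step_d x (Old u))"
    using y d_self by (auto simp: step_d_def core_d_def)
  then show ?thesis using Leaf y by (auto simp: step_A_iff)
next
  case (Ins u v)
  then have uv: "(u, v) \<in> A" using y by simp
  note V = arc_verts[OF uv] and adj = d_adjacent[OF uv] d_adjacent[OF arc_sym[OF uv]]
  note nf = step_V_near_far[OF x]
  have "u \<noteq> v" using adj d_self V by auto
  have "step_d x y = Suc (step_d x (Old u)) \<longleftrightarrow> step_d x y \<noteq> Suc (step_d x (Ins v u))"
  proof -
    consider "x = Old u" | "x = Ins v u" | "x \<noteq> Old u" "x \<noteq> Ins v u" by blast
    then show ?thesis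
    proof cases
      case 3
      \<comment> \<open>\<open>Old u\<close> is closer than \<open>Ins u v\<close> exactly if
        \<open>near x\<close> is closer to \<open>u\<close> than to \<open>v\<close>;
        \<open>Ins v u\<close> is closer exactly if \<open>far x\<close> is closer to
        \<open>v\<close> than to \<open>u\<close>. So \<open>near x\<close> and \<open>far x\<close>
        must lie on the same side of the edge \<open>uv\<close>. By \<open>parallel_arcs\<close>
        this can fail only if \<open>x\<close> is one of the two vertices inserted into that
        edge.\<close>
      have "d (near x) v = Suc (d (near x) u) \<longleftrightarrow> d (far x) v = Suc (d (far x) u)"
        using nf(3)
      proof
        assume nfA: "(near x, far x) \<in> A"
        then have "x = Ins (near x) (far x)"
          using d_adjacent[OF nfA] d_self nf by (cases x) auto
        then have "\<not> (near x = u \<and> far x = v)" "\<not> (near x = v \<and> far x = u)"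
          using 3 y Ins by auto
        then show ?thesis
          using parallel_arcs[OF nfA uv] parallel_arcs[OF nfA arc_sym[OF uv]]
            d_arc[OF nf(1) uv] d_arc[OF nf(2) uv] by auto
      qed simp
      moreover have "step_d x y = height x + d (near x) u + d (far x) u + d (near x) v"
        using Ins y by (simp add: step_d_def core_d_def)
      moreover have "step_d x (Old u) = height x + d (near x) u + d (far x) u + d (near x) u"
        "step_d x (Ins v u) = height x + d (near x) v + d (far x) v + d (near x) u"
        using 3 by (simp_all add: step_d_def core_d_def)
      ultimately show ?thesis
        using d_arc[OF nf(1) uv] d_arc[OF nf(2) uv] by arith
    qed (use Ins adj V d_self \<open>u \<noteq> v\<close> in \<open>auto simp: step_d_def core_d_def\<close>)
  qed
  then show ?thesis unfolding Ins step_A_iff using uv by blast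
next
  case (Old u)
  then have u: "u \<in> V" using y by simp
  note nf = step_V_near_far[OF x]
  have leaf: "step_d x (Old u) = Suc (step_d x (Leaf u i)) \<longleftrightarrow> x = Leaf u i" for i
    using d_self[OF u] Old y by (auto simp: step_d_def core_d_def)
  have ins: "step_d x (Old u) = Suc (step_d x (Ins u v)) \<longleftrightarrow>
      x = Ins u v \<or> d (near x) u = Suc (d (near x) v)" if uv: "(u, v) \<in> A" for v
    using d_self[OF u] d_adjacent[OF uv] d_adjacent[OF arc_sym[OF uv]] d_arc[OF nf(1) uv] Old y
    by (auto simp: step_d_def core_d_def)
  have nbr: "(Old u, p) \<in> step_A \<and> step_d x (Old u) = Suc (step_d x p) \<longleftrightarrow>
      (\<exists>v. (u, v) \<in> A \<and> p = Ins u v \<and> (x = Ins u v \<or> d (near x) u = Suc (d (near x) v))) \<or>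
      (\<exists>i<deg u. p = Leaf u i \<and> x = Leaf u i)" for p
    using leaf ins u unfolding step_A_iff by blast
  consider "near x = u" | "near x \<noteq> u" by blast
  then show ?thesis
  proof cases
    case 1
    then show ?thesis
      unfolding Old nbr using x y(2) Old d_self[OF u] by (intro ex1I[of _ x]; cases x) auto
  next
    case 2
    then obtain v where v: "(u, v) \<in> A" "d (near x) u = Suc (d (near x) v)"
      and uniq: "\<And>w. (u, w) \<in> A \<Longrightarrow> d (near x) u = Suc (d (near x) w) \<Longrightarrow> w = v"
      using parent[OF nf(1) u] by blast
    show ?thesis
      unfolding Old nbr using 2 v uniq by (intro ex1I[of _ "Ins u v"]) auto
  qed
qed

lemma step_A_verts: "step_A \<subseteq> step_V \<times> step_V"
  by (auto simp: step_A_def step_V_def dest: arc_verts intro: arc_sym)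

lemma step_tree_metric: "tree_metric step_V step_A step_d"
proof
  show "finite step_V"
    using finite_V finite_A by (auto simp: step_V_def)
  show "(y, x) \<in> step_A" if "(x, y) \<in> step_A" for x y
    using that by (auto simp: step_A_def intro: arc_sym)
  show "step_d x y = step_d y x" if "x \<in> step_V" "y \<in> step_V" for x y
    using step_V_near_far[OF that(1)] step_V_near_far[OF that(2)]
    by (simp add: step_d_def core_d_def d_commute)
qed (use step_A_verts step_d_arc step_parent in \<open>auto simp: step_d_def\<close>)

section \<open>Distance sums of the new tree\<close>

lemma sum_step_V:
  fixes g :: "'a step_vertex \<Rightarrow> real"
  shows "(\<Sum>x\<in>step_V. g x) =
    (\<Sum>v\<in>V. g (Old v)) + (\<Sum>(u, v)\<in>A. g (Ins u v)) + (\<Sum>v\<in>V. \<Sum>i<deg v. g (Leaf v i))"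
proof -
  let ?L = "SIGMA v:V. {..<deg v}"
  have fin: "finite ?L" using finite_V by auto
  have "(\<Sum>x\<in>step_V. g x) =
    sum g (Old ` V) + sum g ((\<lambda>(u, v). Ins u v) ` A) + sum g ((\<lambda>(v, i). Leaf v i) ` ?L)"
    unfolding step_V_def using finite_V finite_A fin
    by (subst sum.union_disjoint; (subst sum.union_disjoint)?) auto
  also have "sum g (Old ` V) = (\<Sum>v\<in>V. g (Old v))"
    by (subst sum.reindex) (auto simp: inj_on_def)
  also have "sum g ((\<lambda>(u, v). Ins u v) ` A) = (\<Sum>(u, v)\<in>A. g (Ins u v))"
    by (subst sum.reindex) (auto simp: inj_on_def intro!: sum.cong)
  also have "sum g ((\<lambda>(v, i). Leaf v i) ` ?L) = (\<Sum>(v, i)\<in>?L. g (Leaf v i))"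
    by (subst sum.reindex) (auto simp: inj_on_def intro!: sum.cong)
  also have "\<dots> = (\<Sum>v\<in>V. \<Sum>i<deg v. g (Leaf v i))"
    using finite_V by (subst sum.Sigma) auto
  finally show ?thesis .
qed

text \<open>Located at \<open>v\<close> are \<open>v\<close> itself, \<open>deg v\<close> inserted
  vertices and \<open>deg v\<close> leaves. For \<open>far\<close> the vertices inserted next to the
  neighbours of \<open>v\<close> are counted instead; reversing arcs shows that there are equally
  many.\<close>

lemma sum_step_V_near_far:
  fixes f :: "'a \<Rightarrow> real"
  shows "(\<Sum>x\<in>step_V. f (near x)) = (\<Sum>v\<in>V. (1 + 2 * real (deg v)) * f v)"
    and "(\<Sum>x\<in>step_V. f (far x)) = (\<Sum>v\<in>V. (1 + 2 * real (deg v)) * f v)"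
proof -
  have leaf: "(\<Sum>v\<in>V. \<Sum>i<deg v. f v) = (\<Sum>(u, v)\<in>A. f u)"
    by (simp add: sum_arcs_fst)
  have "(\<Sum>v\<in>V. f v) + (\<Sum>(u, v)\<in>A. f u) + (\<Sum>(u, v)\<in>A. f u) =
      (\<Sum>v\<in>V. (1 + 2 * real (deg v)) * f v)"
    unfolding sum_arcs_fst sum.distrib[symmetric] by (intro sum.cong) (auto simp: algebra_simps)
  then show "(\<Sum>x\<in>step_V. f (near x)) = (\<Sum>v\<in>V. (1 + 2 * real (deg v)) * f v)"
    and "(\<Sum>x\<in>step_V. f (far x)) = (\<Sum>v\<in>V. (1 + 2 * real (deg v)) * f v)"
    using sum_arcs_swap[of "\<lambda>u v. f u"] leaf by (simp_all add: sum_step_V)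
qed

context
  fixes n S :: real
  assumes ne: "V \<noteq> {}"
  defines "n \<equiv> real (card V)" and "S \<equiv> (\<Sum>x\<in>V. \<Sum>y\<in>V. real (d x y))"
begin

lemma card_step_V: "real (card step_V) = n + 4 * (n - 1)"
  using sum_step_V_near_far(1)[of "\<lambda>_. 1"] sum_deg[OF ne]
  by (simp add: sum.distrib sum_distrib_left[symmetric] n_def)

lemma sum_height: "(\<Sum>x\<in>step_V. real (height x)) = 2 * (n - 1)"
  using sum_deg[OF ne] by (simp add: sum_step_V n_def)

text \<open>This is the total excess of \<open>core_d\<close> over \<open>step_d\<close>: 2 for each
  of the \<open>2 * (n - 1)\<close> inserted vertices and each of the equally many new
  leaves.\<close>

lemma sum_core_d_self: "(\<Sum>x\<in>step_V. real (core_d x x)) = 8 * (n - 1)"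
proof -
  have "(\<Sum>(u, v)\<in>A. real (core_d (Ins u v) (Ins u v))) = (\<Sum>(u, v)\<in>A. 2)"
    using d_adjacent arc_sym d_self arc_verts
    by (intro sum.cong) (fastforce simp: core_d_def)+
  also have "\<dots> = 4 * (n - 1)"
    using card_A[OF ne] by (simp add: n_def split_def)
  finally show ?thesis
    using sum_deg[OF ne] d_self by (simp add: sum_step_V core_d_def sum_distrib_right[symmetric] n_def)
qed

text \<open>The three distance terms of \<open>core_d\<close> have the same double sum
  \<open>?Q\<close>, whichever of \<open>near\<close> and \<open>far\<close> occur. The two height
  terms are summed separately, and the excess on the diagonal is subtracted.\<close>

lemma sum_step_d:
  "(\<Sum>x\<in>step_V. \<Sum>y\<in>step_V. real (step_d x y)) = 75 * S - 40 * n * (n - 1)"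
proof -
  interpret step: tree_metric step_V step_A step_d by (rule step_tree_metric)
  let ?w = "\<lambda>v. 1 + 2 * real (deg v)"
  let ?Q = "\<Sum>x\<in>V. \<Sum>y\<in>V. ?w x * ?w y * real (d x y)"
  have Q: "(\<Sum>x\<in>step_V. \<Sum>y\<in>step_V. real (d (f x) (g y))) = ?Q"
    if "f = near \<or> f = far" "g = near \<or> g = far" for f g
  proof -
    have "(\<Sum>x\<in>step_V. \<Sum>y\<in>step_V. real (d (f x) (g y))) = (\<Sum>x\<in>step_V. \<Sum>v\<in>V. ?w v * real (d (f x) v))"
      using that(2) sum_step_V_near_far by (intro sum.cong) auto
    also have "\<dots> = (\<Sum>u\<in>V. ?w u * (\<Sum>v\<in>V. ?w v * real (d u v)))"
      using that(1) sum_step_V_near_far[of "\<lambda>u. \<Sum>v\<in>V. ?w v * real (d u v)"] by auto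
    finally show ?thesis by (simp add: sum_distrib_left mult.assoc)
  qed
  have "(\<Sum>y\<in>step_V. real (step_d x y)) = (\<Sum>y\<in>step_V. real (core_d x y)) - real (core_d x x)"
    if "x \<in> step_V" for x
  proof -
    have "(\<Sum>y\<in>step_V - {x}. real (step_d x y)) = (\<Sum>y\<in>step_V - {x}. real (core_d x y))"
      by (intro sum.cong) (auto simp: step_d_def)
    then show ?thesis
      using sum.remove[OF step.finite_V that, of "\<lambda>y. real (step_d x y)"]
        sum.remove[OF step.finite_V that, of "\<lambda>y. real (core_d x y)"] by (simp add: step_d_def)
  qed
  then have "(\<Sum>x\<in>step_V. \<Sum>y\<in>step_V. real (step_d x y)) =
      (\<Sum>x\<in>step_V. \<Sum>y\<in>step_V. real (core_d x y)) - 8 * (n - 1)"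
    by (simp add: sum_subtractf sum_core_d_self)
  also have "(\<Sum>x\<in>step_V. \<Sum>y\<in>step_V. real (core_d x y)) =
      2 * real (card step_V) * (\<Sum>x\<in>step_V. real (height x)) + 3 * ?Q"
    by (simp add: core_d_def sum.distrib sum_distrib_left[symmetric] Q)
  also have "\<dots> - 8 * (n - 1) = 75 * S - 40 * n * (n - 1)"
    unfolding card_step_V sum_height sum_weighted_dist[OF ne] n_def[symmetric] S_def[symmetric] by algebra
  finally show ?thesis .
qed

end

end

section \<open>Arbitrary names of the new vertices\<close>

lemma tree_metric_inj_image:
  assumes "tree_metric V A d" and inj: "inj_on f V"
  defines "g \<equiv> the_inv_into V f"
  shows "tree_metric (f ` V) (map_prod f f ` A) (\<lambda>x y. d (g x) (g y))"
proof -
  interpret tree_metric V A d by fact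
  have g: "g (f x) = x" if "x \<in> V" for x
    using that inj by (simp add: g_def the_inv_into_f_f)
  show ?thesis
  proof
    show "d (g x) (g u) = Suc (d (g x) (g v)) \<or> d (g x) (g v) = Suc (d (g x) (g u))"
      if xuv: "x \<in> f ` V" "(u, v) \<in> map_prod f f ` A" for x u v
    proof -
      obtain x' u' v' where "x = f x'" "u = f u'" "v = f v'" "x' \<in> V" "(u', v') \<in> A"
        using xuv by auto
      then show ?thesis using d_arc[of x' u' v'] arc_verts[of u' v'] by (simp add: g)
    qed
    show "\<exists>!p. (y, p) \<in> map_prod f f ` A \<and> d (g x) (g y) = Suc (d (g x) (g p))"
      if xy: "x \<in> f ` V" "y \<in> f ` V" "y \<noteq> x" for x y
    proof -
      obtain x' y' where x'y': "x = f x'" "y = f y'" "x' \<in> V" "y' \<in> V" "y' \<noteq> x'"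
        using xy by blast
      have arc: "(f y', p) \<in> map_prod f f ` A \<longleftrightarrow> (\<exists>q. (y', q) \<in> A \<and> p = f q)" for p
      proof
        assume "(f y', p) \<in> map_prod f f ` A"
        then obtain a q where "(a, q) \<in> A" "f y' = f a" "p = f q" by auto
        then show "\<exists>q. (y', q) \<in> A \<and> p = f q"
          using inj_onD[OF inj, of y' a] x'y' arc_verts by blast
      qed force
      obtain q where q: "(y', q) \<in> A" "d x' y' = Suc (d x' q)"
        and uniq: "\<And>r. (y', r) \<in> A \<Longrightarrow> d x' y' = Suc (d x' r) \<Longrightarrow> r = q"
        using parent[OF x'y'(3-5)] by blast
      show ?thesis
        unfolding x'y'(1,2) arc g[OF x'y'(3)] g[OF x'y'(4)]
      proof (rule ex1I[of _ "f q"])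
        show "(\<exists>r. (y', r) \<in> A \<and> f q = f r) \<and> d x' y' = Suc (d x' (g (f q)))"
          using q g[OF arc_verts(2)[OF q(1)]] by auto
        fix p
        assume "(\<exists>r. (y', r) \<in> A \<and> p = f r) \<and> d x' y' = Suc (d x' (g p))"
        then obtain r where r: "(y', r) \<in> A" "p = f r" "d x' y' = Suc (d x' (g p))" by blast
        then show "p = f q"
          using uniq[of r] g[OF arc_verts(2)[OF r(1)]] by simp
      qed
    qed
  qed (use finite_V arcs_in_V arc_sym d_self d_commute in \<open>auto simp: g\<close>)
qed

lemma wiener_index_eq:
  assumes "tree_metric (pverts G) (parcs G) d"
  shows "wiener_index G = 1 / 2 * (\<Sum>x\<in>pverts G. \<Sum>y\<in>pverts G. real (d x y))"
  using tree_metric.graph_dist_eq[OF assms] by (simp add: wiener_index_def)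

text \<open>The injectivity and disjointness conditions on \<open>ins\<close> and
  \<open>leaf\<close> make the naming injective on \<open>step_V\<close>, so the explicit distance
  is transported along it. Halving the sum over ordered pairs turns 40 into 20.\<close>

lemma algorithm_I_step_wiener:
  fixes G H :: "'a pair_pre_digraph" and n :: real
  assumes tm: "tree_metric (pverts G) (parcs G) d" and ne: "pverts G \<noteq> {}"
    and step: "algorithm_I_step G H"
  defines "n \<equiv> real (card (pverts G))"
  obtains d' where "tree_metric (pverts H) (parcs H) d'" "pverts H \<noteq> {}"
    "real (card (pverts H)) = n + 4 * (n - 1)"
    "wiener_index H = 75 * wiener_index G - 20 * n * (n - 1)"
proof -
  interpret tree_metric "pverts G" "parcs G" d by fact
  have "out_arcs (with_proj G) v = Pair v ` (parcs G `` {v})" for v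
    by (auto simp: out_arcs_def)
  then have deg: "out_degree (with_proj G) v = deg v" for v
    by (simp add: out_degree_def deg_def card_image inj_on_def)
  then have slots: "leaf_slots G = (SIGMA v:pverts G. {..<deg v})"
    by (auto simp: leaf_slots_def)
  obtain ins leaf where inj: "inj_on ins (parcs G)" "inj_on leaf (leaf_slots G)"
    and disj: "ins ` parcs G \<inter> pverts G = {}" "leaf ` leaf_slots G \<inter> pverts G = {}"
      "ins ` parcs G \<inter> leaf ` leaf_slots G = {}"
    and pverts_H: "pverts H = pverts G \<union> ins ` parcs G \<union> leaf ` leaf_slots G"
    and parcs_H: "parcs H =
      (\<Union>(u, v)\<in>parcs G. {(u, ins (u, v)), (ins (u, v), u), (ins (u, v), ins (v, u))}) \<union>
      (\<Union>(v, i)\<in>leaf_slots G. {(v, leaf (v, i)), (leaf (v, i), v)})"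
    using step unfolding algorithm_I_step_def by (elim exE conjE) (rule that)
  define f where "f = case_step_vertex (\<lambda>v. v) (\<lambda>u v. ins (u, v)) (\<lambda>v i. leaf (v, i))"
  have f [simp]: "f (Old v) = v" "f (Ins u v) = ins (u, v)" "f (Leaf v i) = leaf (v, i)" for u v i
    by (simp_all add: f_def)
  have verts: "pverts H = f ` step_V"
    unfolding pverts_H step_V_def slots by (simp add: image_Un image_image split_def)
  have arcs: "parcs H = map_prod f f ` step_A"
    unfolding parcs_H step_A_def slots by (simp add: image_Un image_UN split_def)
  have ins_ins: "e = e'" if "ins e = ins e'" "e \<in> parcs G" "e' \<in> parcs G" for e e'
    using that by (rule inj_onD[OF inj(1)])
  have leaf_leaf: "s = s'" if "leaf s = leaf s'" "s \<in> leaf_slots G" "s' \<in> leaf_slots G" for s s'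
    using that by (rule inj_onD[OF inj(2)])
  have ins_old: "ins e \<noteq> v" if "e \<in> parcs G" "v \<in> pverts G" for e v
    using that disj(1) by blast
  have leaf_old: "leaf s \<noteq> v" if "s \<in> leaf_slots G" "v \<in> pverts G" for s v
    using that disj(2) by blast
  have ins_leaf: "ins e \<noteq> leaf s" if "e \<in> parcs G" "s \<in> leaf_slots G" for e s
    using that disj(3) by blast
  have inj_f: "inj_on f step_V"
  proof (rule inj_onI)
    fix x y
    assume "x \<in> step_V" "y \<in> step_V" "f x = f y"
    then show "x = y"
      using slots by (cases x; cases y)
        (auto dest: ins_ins leaf_leaf simp: ins_old leaf_old ins_leaf ins_old[symmetric] leaf_old[symmetric] ins_leaf[symmetric])
  qed
  define d' where "d' x y = step_d (the_inv_into step_V f x) (the_inv_into step_V f y)" for x y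
  have tm': "tree_metric (pverts H) (parcs H) d'"
    unfolding verts arcs d'_def by (rule tree_metric_inj_image[OF step_tree_metric inj_f])
  have "(\<Sum>x\<in>pverts H. \<Sum>y\<in>pverts H. real (d' x y)) = (\<Sum>x\<in>step_V. \<Sum>y\<in>step_V. real (step_d x y))"
    unfolding verts
    by (simp add: sum.reindex[OF inj_f] d'_def the_inv_into_f_f[OF inj_f])
  then have "wiener_index H = 75 * wiener_index G - 20 * n * (n - 1)"
    unfolding wiener_index_eq[OF tm'] wiener_index_eq[OF tm] n_def sum_step_d[OF ne] by simp
  moreover have "real (card (pverts H)) = n + 4 * (n - 1)"
    by (simp add: verts card_image[OF inj_f] card_step_V[OF ne] n_def)
  ultimately show thesis
    using that tm' ne pverts_H by blast
qed

section \<open>Iterating the step\<close>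

text \<open>With \<open>m = n - 1\<close> the step reads \<open>m \<mapsto> 5 m\<close>,
  \<open>W \<mapsto> 75 W - 20 (m^2 + m)\<close>. A particular solution is
  \<open>2/5 m^2 + 2/7 m\<close>, from \<open>20 / (75 - 25)\<close> and
  \<open>20 / (75 - 5)\<close>; the deviation from it is multiplied by 75.\<close>

lemma algorithm_I_sequence_wiener:
  fixes T :: "nat \<Rightarrow> 'a pair_pre_digraph" and n0 W0 :: real
  assumes tm: "tree_metric (pverts (T 0)) (parcs (T 0)) d" and ne: "pverts (T 0) \<noteq> {}"
    and seq: "algorithm_I_sequence T"
  defines "n0 \<equiv> real (card (pverts (T 0)))" and "W0 \<equiv> wiener_index (T 0)"
  shows "real (card (pverts (T t))) = 5 ^ t * (n0 - 1) + 1"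
    and "wiener_index (T t) = 75 ^ t * W0 -
      4 * 5 ^ t * ((15 ^ t - 5 ^ t) / 10 * (n0 - 1)\<^sup>2 + (15 ^ t - 1) / 14 * (n0 - 1))"
proof -
  have "(\<exists>d. tree_metric (pverts (T t)) (parcs (T t)) d) \<and> pverts (T t) \<noteq> {} \<and>
    real (card (pverts (T t))) = 5 ^ t * (n0 - 1) + 1 \<and>
    wiener_index (T t) = 75 ^ t * W0 -
      4 * 5 ^ t * ((15 ^ t - 5 ^ t) / 10 * (n0 - 1)\<^sup>2 + (15 ^ t - 1) / 14 * (n0 - 1))"
  proof (induct t)
    case 0
    then show ?case using tm ne by (auto simp: n0_def W0_def)
  next
    case (Suc t)
    \<comment> \<open>All powers are monomials in \<open>5 ^ t\<close> and \<open>3 ^ t\<close>, so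
      the inductive step becomes a polynomial identity.\<close>
    define k where "k = (5::real) ^ t"
    define l where "l = (3::real) ^ t"
    have pow: "(15::real) ^ t = k * l" "(75::real) ^ t = k\<^sup>2 * l" "(5::real) ^ t = k"
      by (simp_all add: k_def l_def power2_eq_square power_mult_distrib[symmetric])
    obtain d where d: "tree_metric (pverts (T t)) (parcs (T t)) d" "pverts (T t) \<noteq> {}"
      using Suc by blast
    have "algorithm_I_step (T t) (T (Suc t))"
      using seq by (simp add: algorithm_I_sequence_def)
    from algorithm_I_step_wiener[OF d this] Suc show ?case
      by (auto simp: pow power2_eq_square field_simps)
  qed
  then show "real (card (pverts (T t))) = 5 ^ t * (n0 - 1) + 1"
    and "wiener_index (T t) = 75 ^ t * W0 -
      4 * 5 ^ t * ((15 ^ t - 5 ^ t) / 10 * (n0 - 1)\<^sup>2 + (15 ^ t - 1) / 14 * (n0 - 1))"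
    by blast+
qed

text \<open>\<open>M\<close> stands for \<open>n0 - 1\<close>. The numerator has order
  \<open>75 ^ t\<close> and the denominator order \<open>25 ^ t\<close>, leaving
  \<open>3 ^ t\<close>. The upper bound drops the subtracted terms and the \<open>1\<close> in the
  denominator; the lower one drops positive terms of slower growth and uses
  \<open>k * M + 1 \<le> k * (M + 1)\<close> for \<open>k = 5 ^ t\<close>.\<close>

lemma avg_bounds:
  fixes M W :: real and t :: nat
  assumes M: "1 \<le> M" and W: "(M + 1) * M / 2 \<le> W"
  defines "a \<equiv> 2 / (5 ^ t * M * (5 ^ t * M + 1)) *
    (75 ^ t * W - 4 * 5 ^ t * ((15 ^ t - 5 ^ t) / 10 * M\<^sup>2 + (15 ^ t - 1) / 14 * M))"
  shows "2 * (W - 2 / 5 * M\<^sup>2 - 2 / 7 * M) / (M * (M + 1)) * 3 ^ t \<le> a"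
    and "a \<le> 2 * W / M\<^sup>2 * 3 ^ t"
    and "0 < W - 2 / 5 * M\<^sup>2 - 2 / 7 * M"
proof -
  define k where "k = (5::real) ^ t"
  define l where "l = (3::real) ^ t"
  have pow: "(15::real) ^ t = k * l" "(75::real) ^ t = k\<^sup>2 * l" "(5::real) ^ t = k" "3 ^ t = l"
    by (simp_all add: k_def l_def power2_eq_square power_mult_distrib[symmetric])
  have k: "1 \<le> k" and l: "1 \<le> l" by (simp_all add: k_def l_def)
  define F where "F = k\<^sup>2 * l * W - 4 * k * ((k * l - k) / 10 * M\<^sup>2 + (k * l - 1) / 14 * M)"
  have a: "a = 2 * F / (k * M * (k * M + 1))"
    by (simp add: a_def pow F_def)
  have MW: "M \<le> M\<^sup>2" "M\<^sup>2 + M \<le> 2 * W"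
    using M W by (simp_all add: power2_eq_square distrib_right)
  \<comment> \<open>The factor 35 clears the denominators 5 and 7; the right side is at least
    \<open>35 / 2 * (M^2 + M)\<close>.\<close>
  then have "10 * M + 14 * M\<^sup>2 < 35 * W" using M by linarith
  then show c: "0 < W - 2 / 5 * M\<^sup>2 - 2 / 7 * M" by (simp add: field_simps)
  have kl: "1 \<le> k * l" "k \<le> k * l" using k l mult_mono[of 1 k 1 l] by auto
  have upF: "F \<le> k\<^sup>2 * l * W"
  proof -
    have "0 \<le> (k * l - k) / 10 * M\<^sup>2 + (k * l - 1) / 14 * M" using kl M by simp
    then have "0 \<le> 4 * k * ((k * l - k) / 10 * M\<^sup>2 + (k * l - 1) / 14 * M)" using k by simp
    then show ?thesis by (simp add: F_def)
  qed
  have loF: "k\<^sup>2 * l * (W - 2 / 5 * M\<^sup>2 - 2 / 7 * M) \<le> F"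
  proof -
    \<comment> \<open>The remainder consists of the slower terms, of orders \<open>25 ^ t\<close>
      and \<open>5 ^ t\<close>.\<close>
    have "F - k\<^sup>2 * l * (W - 2 / 5 * M\<^sup>2 - 2 / 7 * M) = 2 / 5 * k\<^sup>2 * M\<^sup>2 + 2 / 7 * k * M"
      by (simp add: F_def power2_eq_square field_simps)
    moreover have "0 \<le> 2 / 5 * k\<^sup>2 * M\<^sup>2 + 2 / 7 * k * M" using k M by simp
    ultimately show ?thesis by linarith
  qed
  have "0 < k * M" using k M by (intro mult_pos_pos) auto
  then have kM: "0 < k * M" "0 < k * M + 1" by linarith+
  then have pos: "0 < k * M * (k * M + 1)" by (rule mult_pos_pos)
  have "0 < W" using MW M by linarith
  have "a \<le> 2 * (k\<^sup>2 * l * W) / (k * M * (k * M + 1))"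
    unfolding a using pos upF by (intro divide_right_mono) auto
  also have "\<dots> \<le> 2 * (k\<^sup>2 * l * W) / (k * M * (k * M))"
    using k M l kM \<open>0 < W\<close> by (intro divide_left_mono mult_left_mono mult_pos_pos) auto
  also have "\<dots> = 2 * W / M\<^sup>2 * 3 ^ t"
    using k M by (simp add: pow power2_eq_square field_simps)
  finally show "a \<le> 2 * W / M\<^sup>2 * 3 ^ t" .
  let ?c = "W - 2 / 5 * M\<^sup>2 - 2 / 7 * M"
  have "2 * ?c / (M * (M + 1)) * 3 ^ t = 2 * (k\<^sup>2 * l * ?c) / (k * M * (k * (M + 1)))"
    using k M by (simp add: pow power2_eq_square)
  also have "\<dots> \<le> 2 * (k\<^sup>2 * l * ?c) / (k * M * (k * M + 1))"
    using k M l c pos kM by (intro divide_left_mono mult_left_mono mult_pos_pos) (auto simp: distrib_left)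
  also have "\<dots> \<le> a"
    unfolding a using pos loF by (intro divide_right_mono) auto
  finally show "2 * ?c / (M * (M + 1)) * 3 ^ t \<le> a" .
qed

text \<open>The exponent is chosen so that \<open>5 powr (ln 3 / ln 5) = 3\<close>.\<close>

lemma five_power_powr: "((5::real) ^ t) powr (ln 3 / ln 5) = 3 ^ t"
proof -
  have "(5::real) powr (ln 3 / ln 5) = 3" by (simp add: powr_def)
  then have "(3::real) ^ t = (5 powr (ln 3 / ln 5)) powr real t" by (simp add: powr_realpow)
  also have "\<dots> = (5 powr real t) powr (ln 3 / ln 5)" by (simp add: powr_powr mult.commute)
  finally show ?thesis by (simp add: powr_realpow)
qed

theorem mainTheorem6:
  fixes T :: "nat \<Rightarrow> 'a pair_pre_digraph" and n0 W0 :: real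
  assumes tree: "undirected_tree (T 0)"
    and size: "card (pverts (T 0)) \<ge> 2"
    and seq: "algorithm_I_sequence T"
    and n0: "n0 = real (card (pverts (T 0)))"
    and W0: "W0 = wiener_index (T 0)"
  shows "(\<forall>t. avg_path_length (T t) =
            2 / (5 ^ t * (n0 - 1) * (5 ^ t * (n0 - 1) + 1)) *
            (75 ^ t * W0 -
             4 * 5 ^ t * ((15 ^ t - 5 ^ t) / 10 * (n0 - 1)\<^sup>2 + (15 ^ t - 1) / 14 * (n0 - 1)))) \<and>
         (\<lambda>t. avg_path_length (T t)) \<in> \<Theta>(\<lambda>t. 3 ^ t) \<and>
         (\<lambda>t. 3 ^ t) \<in> \<Theta>(\<lambda>t. real (card (pverts (T t))) powr (ln 3 / ln 5))"
proof -
  obtain d where tm: "tree_metric (pverts (T 0)) (parcs (T 0)) d"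
    using tree_metric_of_undirected_tree[OF tree] .
  interpret tree_metric "pverts (T 0)" "parcs (T 0)" d by fact
  have "pverts (T 0) \<noteq> {}" using size by auto
  note seq_wiener = algorithm_I_sequence_wiener[OF tm this seq, folded n0 W0]
  have M: "1 \<le> n0 - 1" using size n0 by simp
  have W: "(n0 - 1 + 1) * (n0 - 1) / 2 \<le> W0"
    using sum_dist_ge by (simp add: W0 n0 wiener_index_eq[OF tm])
  have avg: "avg_path_length (T t) = 2 / (5 ^ t * (n0 - 1) * (5 ^ t * (n0 - 1) + 1)) *
      (75 ^ t * W0 -
       4 * 5 ^ t * ((15 ^ t - 5 ^ t) / 10 * (n0 - 1)\<^sup>2 + (15 ^ t - 1) / 14 * (n0 - 1)))" for t
    unfolding avg_path_length_def seq_wiener by (simp add: mult.commute)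
  \<comment> \<open>Both constants come from \<open>avg_bounds\<close> with
    \<open>M = n0 - 1\<close>, and they work for every \<open>t\<close>, not just
    eventually.\<close>
  let ?c = "2 * (W0 - 2 / 5 * (n0 - 1)\<^sup>2 - 2 / 7 * (n0 - 1)) / ((n0 - 1) * (n0 - 1 + 1))"
  have "(\<lambda>t. avg_path_length (T t)) \<in> \<Theta>(\<lambda>t. 3 ^ t)"
  proof (rule bigthetaI'[of ?c "2 * W0 / (n0 - 1)\<^sup>2"])
    have "0 < W0" using W M by (smt (verit) mult_pos_pos half_gt_zero)
    then show "0 < 2 * W0 / (n0 - 1)\<^sup>2" using M by simp
    show c: "0 < ?c" using avg_bounds(3)[OF M W] M by (intro divide_pos_pos mult_pos_pos) auto
    show "\<forall>\<^sub>F t in at_top. ?c * norm ((3::real) ^ t) \<le> norm (avg_path_length (T t)) \<and>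
        norm (avg_path_length (T t)) \<le> 2 * W0 / (n0 - 1)\<^sup>2 * norm ((3::real) ^ t)"
    proof (intro always_eventually allI)
      fix t
      have b: "?c * 3 ^ t \<le> avg_path_length (T t)" "avg_path_length (T t) \<le> 2 * W0 / (n0 - 1)\<^sup>2 * 3 ^ t"
        unfolding avg using avg_bounds(1,2)[OF M W] by auto
      moreover have "0 < ?c * 3 ^ t" using mult_pos_pos[OF c] by simp
      ultimately show "?c * norm ((3::real) ^ t) \<le> norm (avg_path_length (T t)) \<and>
        norm (avg_path_length (T t)) \<le> 2 * W0 / (n0 - 1)\<^sup>2 * norm ((3::real) ^ t)"
        by simp
    qed
  qed
  \<comment> \<open>The vertex count lies between \<open>5 ^ t * (n0 - 1)\<close> and
    \<open>5 ^ t * n0\<close>. The two sides are exchanged at the end by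
    \<open>bigtheta_sym\<close>.\<close>
  moreover have "(\<lambda>t. real (card (pverts (T t))) powr (ln 3 / ln 5)) \<in> \<Theta>(\<lambda>t. 3 ^ t)"
  proof (rule bigthetaI')
    let ?z = "ln 3 / ln (5::real)"
    show "0 < (n0 - 1) powr ?z" "0 < n0 powr ?z" using M by auto
    show "\<forall>\<^sub>F t in at_top. (n0 - 1) powr ?z * norm ((3::real) ^ t) \<le> norm (real (card (pverts (T t))) powr ?z) \<and>
        norm (real (card (pverts (T t))) powr ?z) \<le> n0 powr ?z * norm ((3::real) ^ t)"
    proof (intro always_eventually allI)
      fix t
      have "(5 ^ t * (n0 - 1)) powr ?z \<le> (5 ^ t * (n0 - 1) + 1) powr ?z"
        using M by (intro powr_mono2) auto
      moreover have "(5 ^ t * (n0 - 1) + 1) powr ?z \<le> (5 ^ t * n0) powr ?z"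
      proof (rule powr_mono2)
        show "0 \<le> 5 ^ t * (n0 - 1) + 1" using M by (intro add_nonneg_nonneg) auto
        show "5 ^ t * (n0 - 1) + 1 \<le> 5 ^ t * n0" by (simp add: right_diff_distrib)
      qed simp
      ultimately show "(n0 - 1) powr ?z * norm ((3::real) ^ t) \<le> norm (real (card (pverts (T t))) powr ?z) \<and>
        norm (real (card (pverts (T t))) powr ?z) \<le> n0 powr ?z * norm ((3::real) ^ t)"
        using M by (simp add: seq_wiener powr_mult five_power_powr mult.commute)
    qed
  qed
  ultimately show ?thesis
    using avg by (auto simp: bigtheta_sym)
qed

end
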